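(* Let $(\gamma,\nu):(I,t_0)\to\mathbb{R}^2\times S^1$ be a Legendre curve of the form $\gamma(t)=(x(t),z(t))$ and $\nu(t)=(\cos\varphi(t),\sin\varphi(t))$ with the curvature $(\dot\varphi,\beta)$. Let $J(t)=-\beta(t)x(t)$ and $K(t)=-\dot\varphi(t)\cos\varphi(t)$. (1) Suppose that $\beta$ is real analytic around $t_0$ and that there exists a function $\alpha:(I,t_0)\to\mathbb{R}$ such that $K(t)=\alpha(t)J(t)$ and $\alpha(t)\beta^2(t)(t-t_0)^2$ is real analytic around $t_0$. Then $x(t)$ is a solution of $$\beta(t)\ddot x(t)-\dot\beta(t)\dot x(t)+\alpha(t)\beta^3(t)x(t)=0$$ around $t_0$, $$z(t)=\pm\int\beta(t)\left(1-\left(\int\alpha(t)\beta(t)x(t)\,dt\right)^2\right)^{\frac12}dt$$ and $$\cos\varphi(t)=\pm\left(1-\left(\int\alpha(t)\beta(t)x(t)\,dt\right)^2\right)^{\frac12},\qquad \sin\varphi(t)=\int\alpha(t)\beta(t)x(t)\,dt.$$ (2) Suppose that $x(t_0)>0$ and that smooth functions $J$ and $K:(I,t_0)\to\mathbb{R}$ are given. Then $(\gamma,\nu)$ is given by $$x(t)=\left(-2\int J(t)\left(\int K(t)\,dt\right)dt\right)^{\frac12},\qquad z(t)=\mp\int\frac{J(t)}{x(t)}\left(1-\left(\int K(t)\,dt\right)^2\right)^{\frac12}dt$$ and $$\cos\varphi(t)=\pm\left(1-\left(\int K(t)\,dt\right)^2\right)^{\frac12},\qquad \sin\varphi(t)=-\int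 K(t)\,dt.$$
   Context: All maps are $C^\infty$ unless stated otherwise; $(I,t_0)$ denotes an interval $I\subset\mathbb{R}$ with base point $t_0\in I$ (statements are local around $t_0$). A Legendre curve is a smooth map $(\gamma,\nu):I\to\mathbb{R}^2\times S^1$ with $\dot\gamma(t)\cdot\nu(t)=0$ for all $t$. With $\boldsymbol{\mu}=(-\sin\varphi,\cos\varphi)$ (the anticlockwise rotation of $\nu=(\cos\varphi,\sin\varphi)$ by $\pi/2$, where $\varphi$ is a smooth function), its curvature is $(\dot\nu\cdot\boldsymbol{\mu},\dot\gamma\cdot\boldsymbol{\mu})=(\dot\varphi,\beta)$, so $\dot x=-\beta\sin\varphi$ and $\dot z=\beta\cos\varphi$. The functions $J$ and $K$ are the first two components $J^z_F,K^z_F$ of the curvature $(J^z_F,K^z_F,H^z_F)$ of the surface of revolution $(x(t)\cos\theta,x(t)\sin\theta,z(t))$ of $\gamma$ around the $z$-axis, regarded as a framed surface; where this surface is regular, $K/J$ is its Gauss curvature. Indefinite integrals denote antiderivatives with suitable integration constants.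
   Formalization: The sign ± is a function with values ±1, placed inside the integral for z and constant on intervals where the radicand is nonzero; a single fixed sign fails, e.g. for φ = π/2 + t, β = 1, x = 1 − sin t at t₀ = 0, where cos φ = −sin t changes sign. *)

theory Defs
  imports "HOL-Analysis.Analysis"
begin

text \<open>
  Derivatives are taken within the parameter interval, so they are one-sided at an end point
  belonging to it and only the values of the function on the interval matter.
  They are meaningful (unique) on intervals with nonempty interior.
\<close>

definition deriv_on :: "real set \<Rightarrow> (real \<Rightarrow> 'a::real_normed_vector) \<Rightarrow> real \<Rightarrow> 'a" where
  "deriv_on I f t = vector_derivative f (at t within I)"

text \<open>\<open>D n\<close> is the derivative of order \<open>n\<close>.\<close>

definition smooth_on :: "real set \<Rightarrow> (real \<Rightarrow> 'a::real_normed_vector) \<Rightarrow> bool" where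
  "smooth_on I f \<longleftrightarrow>
     (\<exists>D :: nat \<Rightarrow> real \<Rightarrow> 'a. (\<forall>t\<in>I. D 0 t = f t) \<and>
        (\<forall>n. \<forall>t\<in>I. (D n has_vector_derivative D (Suc n) t) (at t within I)))"

text \<open>The power series need only represent \<open>f\<close> on \<open>I\<close>, as \<open>t\<^sub>0\<close> may be an end point of \<open>I\<close>.\<close>

definition real_analytic_around :: "real set \<Rightarrow> real \<Rightarrow> (real \<Rightarrow> real) \<Rightarrow> bool" where
  "real_analytic_around I t\<^sub>0 f \<longleftrightarrow>
     (\<exists>r>0. \<exists>a :: nat \<Rightarrow> real.
        (\<forall>t. \<bar>t - t\<^sub>0\<bar> < r \<longrightarrow> summable (\<lambda>n. a n * (t - t\<^sub>0) ^ n)) \<and>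
        (\<forall>t\<in>I. \<bar>t - t\<^sub>0\<bar> < r \<longrightarrow> (\<lambda>n. a n * (t - t\<^sub>0) ^ n) sums f t))"

definition antiderivative_on :: "real set \<Rightarrow> (real \<Rightarrow> real) \<Rightarrow> (real \<Rightarrow> real) \<Rightarrow> bool" where
  "antiderivative_on I f F \<longleftrightarrow> (\<forall>t\<in>I. (F has_real_derivative f t) (at t within I))"

text \<open>
  A choice \<open>\<epsilon>\<close> of the sign in \<open>\<plusminus>(1 - S\<^sup>2)\<^sup>\<onehalf>\<close>: it is constant on every interval on which the
  radicand does not vanish.  It cannot be required to be globally constant, nor constant near the
  base point: for \<open>\<phi> t = pi/2 + t\<close> one has \<open>S = sin \<circ> \<phi>\<close> and \<open>cos (\<phi> t) = - sin t\<close>,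
  which changes sign at \<open>0\<close>.
\<close>

definition sign_choice :: "real set \<Rightarrow> (real \<Rightarrow> real) \<Rightarrow> (real \<Rightarrow> real) \<Rightarrow> bool" where
  "sign_choice I S \<epsilon> \<longleftrightarrow>
     (\<forall>t\<in>I. \<epsilon> t = 1 \<or> \<epsilon> t = - 1) \<and>
     (\<forall>V. V \<subseteq> I \<and> is_interval V \<and> (\<forall>t\<in>V. 1 - (S t)\<^sup>2 \<noteq> 0) \<longrightarrow> \<epsilon> constant_on V)"

text \<open>Legendre curves with values in the plane times the unit circle.\<close>

definition legendre_curve ::
  "real set \<Rightarrow> (real \<Rightarrow> real \<times> real) \<Rightarrow> (real \<Rightarrow> real \<times> real) \<Rightarrow> bool" where
  "legendre_curve I \<gamma> \<nu> \<longleftrightarrow>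
     smooth_on I \<gamma> \<and> smooth_on I \<nu> \<and> (\<forall>t\<in>I. norm (\<nu> t) = 1) \<and>
     (\<forall>t\<in>I. deriv_on I \<gamma> t \<bullet> \<nu> t = 0)"

text \<open>Anticlockwise rotation by \<open>pi/2\<close>.\<close>

definition rot90 :: "real \<times> real \<Rightarrow> real \<times> real" where
  "rot90 v = (- snd v, fst v)"

definition legendre_curvature ::
  "real set \<Rightarrow> (real \<Rightarrow> real \<times> real) \<Rightarrow> (real \<Rightarrow> real \<times> real) \<Rightarrow> real \<Rightarrow> real \<times> real" where
  "legendre_curvature I \<gamma> \<nu> t =
     (deriv_on I \<nu> t \<bullet> rot90 (\<nu> t), deriv_on I \<gamma> t \<bullet> rot90 (\<nu> t))"

end

theory Submission
  imports Defs
begin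

text \<open>
  Since \<open>\<gamma>'\<close> is orthogonal to the unit vector \<open>\<nu>\<close>, it equals \<open>\<beta>\<close> times the rotated normal, so
  \<open>x' = - \<beta> sin \<phi>\<close> and \<open>z' = \<beta> cos \<phi>\<close> (lemma \<open>legendre_coordinates\<close>).  The function \<open>K\<close> is minus the
  derivative of \<open>sin \<phi>\<close>, so \<open>sin \<phi>\<close> is an antiderivative of \<open>- K\<close>, which under \<open>K = \<alpha> J\<close> is
  \<open>\<alpha> \<beta> x\<close>; the function \<open>J sin \<phi> = - \<beta> x sin \<phi> = x x'\<close> is the derivative of \<open>x\<^sup>2 / 2\<close>.
  The integration constants are thereby fixed by the curve itself: \<open>S = sin \<phi>\<close> in the first part,
  \<open>S = - sin \<phi>\<close> and \<open>P = - x\<^sup>2 / 2\<close> in the second.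

  In the second part \<open>x > 0\<close> near the base point by continuity.  This makes \<open>x\<close> the positive square
  root of \<open>- 2 P = x\<^sup>2\<close> and allows \<open>\<beta>\<close> to be recovered as \<open>- J / x\<close> in \<open>z' = \<beta> cos \<phi>\<close>.

  The differential equation comes from differentiating \<open>x' = - \<beta> sin \<phi>\<close> once more and eliminating
  \<open>sin \<phi>\<close> in favour of \<open>x'\<close>.

  The square root \<open>sqrt (1 - S\<^sup>2)\<close> is \<open>\<bar>cos \<phi>\<bar>\<close>; the missing sign is that of the continuous function
  \<open>cos \<phi>\<close>, constant wherever \<open>cos \<phi>\<close> has no zero by the intermediate value theorem (lemma
  \<open>sign_choice_of_unit_circle\<close>).
\<close>

text \<open>An interval with an inner point has no isolated points, so derivatives within it are unique.\<close>

lemma deriv_on_eqI: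
  assumes "is_interval I" "interior I \<noteq> {}" "t \<in> I"
    and "(f has_vector_derivative f') (at t within I)"
  shows "deriv_on I f t = f'"
proof -
  have "I \<noteq> {t}"
    using assms(2) by (metis interior_singleton)
  hence "t islimpt I"
    using assms(1,3) by (intro connected_imp_perfect is_interval_connected) auto
  hence "at t within I \<noteq> bot"
    by (simp add: trivial_limit_within)
  thus ?thesis
    unfolding deriv_on_def using assms(4) by (rule vector_derivative_within)
qed

lemma smooth_on_differentiable:
  assumes "is_interval I" "interior I \<noteq> {}" "smooth_on I f" "t \<in> I"
  shows "(f has_vector_derivative deriv_on I f t) (at t within I)"
proof -
  obtain D where D: "\<And>t. t \<in> I \<Longrightarrow> D 0 t = f t"
      "\<And>n t. t \<in> I \<Longrightarrow> (D n has_vector_derivative D (Suc n) t) (at t within I)"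
    using assms(3) unfolding smooth_on_def by blast
  have "(f has_vector_derivative D 1 t) (at t within I)"
    using has_vector_derivative_transform[OF assms(4), of f "D 0" "D 1 t"] D(1) D(2)[of t 0] assms(4)
    by simp
  thus ?thesis
    using deriv_on_eqI[OF assms(1,2,4)] by metis
qed

lemma smooth_on_deriv_on:
  assumes "is_interval I" "interior I \<noteq> {}" "smooth_on I f"
  shows "smooth_on I (deriv_on I f)"
proof -
  obtain D where D: "\<And>t. t \<in> I \<Longrightarrow> D 0 t = f t"
      "\<And>n t. t \<in> I \<Longrightarrow> (D n has_vector_derivative D (Suc n) t) (at t within I)"
    using assms(3) unfolding smooth_on_def by blast
  have "D 1 t = deriv_on I f t" if "t \<in> I" for t
  proof -
    have "(f has_vector_derivative D 1 t) (at t within I)"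
      using has_vector_derivative_transform[OF that, of f "D 0" "D 1 t"] D(1) D(2)[of t 0] that
      by simp
    thus ?thesis
      using deriv_on_eqI[OF assms(1,2) that] by metis
  qed
  thus ?thesis
    unfolding smooth_on_def using D(2) by (intro exI[of _ "\<lambda>n. D (Suc n)"]) simp
qed

text \<open>The vectors \<open>n\<close> and \<open>rot90 n\<close> form an orthonormal basis of the plane.\<close>

lemma orthogonal_unit_rot90:
  assumes "norm n = 1" "v \<bullet> n = 0"
  shows "v = (v \<bullet> rot90 n) *\<^sub>R rot90 n"
proof -
  obtain a b where v: "v = (a, b)" by (cases v)
  obtain c s where n: "n = (c, s)" by (cases n)
  have u: "c\<^sup>2 + s\<^sup>2 = 1"
    using assms(1) by (simp add: n norm_Pair)
  have o: "a * c + b * s = 0"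
    using assms(2) by (simp add: v n)
  have "a = (b * c - a * s) * - s" "b = (b * c - a * s) * c"
    using u o by algebra+
  thus ?thesis
    by (simp add: v n rot90_def algebra_simps)
qed

lemma legendre_coordinates:
  assumes I: "is_interval I" "interior I \<noteq> {}"
    and leg: "legendre_curve I \<gamma> \<nu>"
    and gamma: "\<forall>t\<in>I. \<gamma> t = (x t, z t)"
    and nu: "\<forall>t\<in>I. \<nu> t = (cos (\<phi> t), sin (\<phi> t))"
    and beta: "\<forall>t\<in>I. snd (legendre_curvature I \<gamma> \<nu> t) = \<beta> t"
    and t: "t \<in> I"
  shows "(x has_real_derivative - \<beta> t * sin (\<phi> t)) (at t within I)"
    and "(z has_real_derivative \<beta> t * cos (\<phi> t)) (at t within I)"
proof -
  have "deriv_on I \<gamma> t = \<beta> t *\<^sub>R rot90 (\<nu> t)"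
    using orthogonal_unit_rot90[of "\<nu> t" "deriv_on I \<gamma> t"] leg beta t
    by (simp add: legendre_curve_def legendre_curvature_def)
  hence "deriv_on I \<gamma> t = (- \<beta> t * sin (\<phi> t), \<beta> t * cos (\<phi> t))"
    using nu t by (simp add: rot90_def)
  moreover have "smooth_on I \<gamma>"
    using leg by (simp add: legendre_curve_def)
  hence "(\<gamma> has_vector_derivative deriv_on I \<gamma> t) (at t within I)"
    by (rule smooth_on_differentiable[OF I _ t])
  ultimately have g: "(\<gamma> has_vector_derivative (- \<beta> t * sin (\<phi> t), \<beta> t * cos (\<phi> t))) (at t within I)"
    by simp
  have "((\<lambda>s. fst (\<gamma> s)) has_vector_derivative - \<beta> t * sin (\<phi> t)) (at t within I)"
    using bounded_linear.has_vector_derivative[OF bounded_linear_fst g] by simp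
  thus "(x has_real_derivative - \<beta> t * sin (\<phi> t)) (at t within I)"
    unfolding has_real_derivative_iff_has_vector_derivative
    by (rule has_vector_derivative_transform[OF t, rotated]) (simp add: gamma)
  have "((\<lambda>s. snd (\<gamma> s)) has_vector_derivative \<beta> t * cos (\<phi> t)) (at t within I)"
    using bounded_linear.has_vector_derivative[OF bounded_linear_snd g] by simp
  thus "(z has_real_derivative \<beta> t * cos (\<phi> t)) (at t within I)"
    unfolding has_real_derivative_iff_has_vector_derivative
    by (rule has_vector_derivative_transform[OF t, rotated]) (simp add: gamma)
qed

text \<open>The function \<open>\<beta>\<close> inherits differentiability from \<open>\<gamma>'\<close> and \<open>\<nu>\<close>, being their product
  \<open>\<gamma>' \<bullet> rot90 \<nu>\<close>; this gives a meaning to \<open>\<beta>'\<close> on all of \<open>I\<close>.\<close>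

lemma legendre_curvature_differentiable:
  assumes I: "is_interval I" "interior I \<noteq> {}"
    and leg: "legendre_curve I \<gamma> \<nu>"
    and beta: "\<forall>t\<in>I. snd (legendre_curvature I \<gamma> \<nu> t) = \<beta> t"
    and t: "t \<in> I"
  shows "(\<beta> has_real_derivative deriv_on I \<beta> t) (at t within I)"
proof -
  have smooth: "smooth_on I \<gamma>" "smooth_on I \<nu>"
    using leg by (simp_all add: legendre_curve_def)
  note g = smooth_on_differentiable[OF I smooth_on_deriv_on[OF I smooth(1)] t]
  note n = smooth_on_differentiable[OF I smooth(2) t]
  have "bounded_linear rot90"
    unfolding rot90_def
    by (intro bounded_linear_Pair bounded_linear_minus bounded_linear_snd bounded_linear_fst)
  note r = bounded_linear.has_vector_derivative[OF this n]
  obtain b where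
    "((\<lambda>s. deriv_on I \<gamma> s \<bullet> rot90 (\<nu> s)) has_vector_derivative b) (at t within I)"
    using bounded_bilinear.has_vector_derivative[OF bounded_bilinear_inner g r] by blast
  hence "(\<beta> has_vector_derivative b) (at t within I)"
    by (rule has_vector_derivative_transform[OF t, rotated])
      (use beta in \<open>simp add: legendre_curvature_def\<close>)
  thus ?thesis
    using deriv_on_eqI[OF I t] has_real_derivative_iff_has_vector_derivative by metis
qed

text \<open>The sign of a continuous function cannot change on an interval without a zero.  At the zeros
  of \<open>c\<close> either value serves, because the square root vanishes there.\<close>

lemma sign_choice_of_unit_circle:
  fixes c S :: "real \<Rightarrow> real"
  assumes cont: "continuous_on I c" and unit: "\<And>t. t \<in> I \<Longrightarrow> (c t)\<^sup>2 + (S t)\<^sup>2 = 1"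
  obtains \<epsilon> where "sign_choice I S \<epsilon>" "\<And>t. t \<in> I \<Longrightarrow> c t = \<epsilon> t * sqrt (1 - (S t)\<^sup>2)"
proof
  define \<epsilon> :: "real \<Rightarrow> real" where "\<epsilon> t = (if c t < 0 then - 1 else 1)" for t
  have sq: "1 - (S t)\<^sup>2 = (c t)\<^sup>2" if "t \<in> I" for t
    using unit[OF that] by simp
  show "c t = \<epsilon> t * sqrt (1 - (S t)\<^sup>2)" if "t \<in> I" for t
    by (simp add: sq[OF that] \<epsilon>_def)
  have "\<epsilon> constant_on V"
    if V: "V \<subseteq> I" "is_interval V" and nz: "\<forall>t\<in>V. 1 - (S t)\<^sup>2 \<noteq> 0" for V
  proof -
    have "connected (c ` V)"
      using V cont
      by (intro connected_continuous_image) (auto simp: is_interval_connected intro: continuous_on_subset)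
    hence ivl: "is_interval (c ` V)"
      by (simp add: is_interval_connected_1)
    have "0 \<notin> c ` V"
      using nz sq V(1) by force
    hence same: "c u < 0" if "s \<in> V" "u \<in> V" "c s < 0" for s u
      using ivl that mem_is_interval_1_I[of "c ` V" "c s" "c u" 0] by force
    show ?thesis
    proof (cases "\<exists>s\<in>V. c s < 0")
      case True
      thus ?thesis using same unfolding constant_on_def \<epsilon>_def by (intro exI[of _ "- 1"]) auto
    next
      case False
      thus ?thesis unfolding constant_on_def \<epsilon>_def by (intro exI[of _ 1]) auto
    qed
  qed
  thus "sign_choice I S \<epsilon>"
    unfolding sign_choice_def by (auto simp: \<epsilon>_def)
qed

theorem theorem3p8:
  fixes I :: "real set" and t\<^sub>0 :: real
    and \<gamma> \<nu> :: "real \<Rightarrow> real \<times> real"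
    and x z \<phi> \<beta> J K :: "real \<Rightarrow> real"
  assumes interval: "is_interval I" "interior I \<noteq> {}" "t\<^sub>0 \<in> I"
    and legendre: "legendre_curve I \<gamma> \<nu>"
    and gamma: "\<forall>t\<in>I. \<gamma> t = (x t, z t)"
    and phi: "smooth_on I \<phi>"
    and nu: "\<forall>t\<in>I. \<nu> t = (cos (\<phi> t), sin (\<phi> t))"
    and curvature: "\<forall>t\<in>I. legendre_curvature I \<gamma> \<nu> t = (deriv_on I \<phi> t, \<beta> t)"
    and J: "\<forall>t\<in>I. J t = - \<beta> t * x t"
    and K: "\<forall>t\<in>I. K t = - deriv_on I \<phi> t * cos (\<phi> t)"
  shows
    "(\<forall>\<alpha> :: real \<Rightarrow> real.
        real_analytic_around I t\<^sub>0 \<beta> \<and>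
        (\<forall>t\<in>I. K t = \<alpha> t * J t) \<and>
        real_analytic_around I t\<^sub>0 (\<lambda>t. \<alpha> t * (\<beta> t)\<^sup>2 * (t - t\<^sub>0)\<^sup>2) \<longrightarrow>
        (\<forall>t\<in>I. \<beta> t * deriv_on I (deriv_on I x) t - deriv_on I \<beta> t * deriv_on I x t
                 + \<alpha> t * (\<beta> t) ^ 3 * x t = 0) \<and>
        (\<exists>S \<epsilon> :: real \<Rightarrow> real.
            antiderivative_on I (\<lambda>t. \<alpha> t * \<beta> t * x t) S \<and>
            sign_choice I S \<epsilon> \<and>
            antiderivative_on I (\<lambda>t. \<epsilon> t * (\<beta> t * sqrt (1 - (S t)\<^sup>2))) z \<and>
            (\<forall>t\<in>I. cos (\<phi> t) = \<epsilon> t * sqrt (1 - (S t)\<^sup>2) \<and> sin (\<phi> t) = S t)))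
     \<and>
     (x t\<^sub>0 > 0 \<and> smooth_on I J \<and> smooth_on I K \<longrightarrow>
        (\<exists>\<delta>>0. \<exists>U. U = I \<inter> {t\<^sub>0 - \<delta><..<t\<^sub>0 + \<delta>} \<and>
          (\<exists>S P \<epsilon> :: real \<Rightarrow> real.
            antiderivative_on U K S \<and>
            antiderivative_on U (\<lambda>t. J t * S t) P \<and>
            sign_choice U S \<epsilon> \<and>
            (\<forall>t\<in>U. x t > 0 \<and> x t = sqrt (- 2 * P t)) \<and>
            antiderivative_on U (\<lambda>t. - \<epsilon> t * (J t / x t * sqrt (1 - (S t)\<^sup>2))) z \<and>
            (\<forall>t\<in>U. cos (\<phi> t) = \<epsilon> t * sqrt (1 - (S t)\<^sup>2) \<and> sin (\<phi> t) = - S t))))"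
proof -
  have beta: "\<forall>t\<in>I. snd (legendre_curvature I \<gamma> \<nu> t) = \<beta> t"
    using curvature by simp
  note x' = legendre_coordinates(1)[OF interval(1,2) legendre gamma nu beta]
  note z' = legendre_coordinates(2)[OF interval(1,2) legendre gamma nu beta]
  note \<beta>' = legendre_curvature_differentiable[OF interval(1,2) legendre beta]
  have \<phi>': "(\<phi> has_real_derivative deriv_on I \<phi> t) (at t within I)" if "t \<in> I" for t
    using smooth_on_differentiable[OF interval(1,2) phi that]
    by (simp add: has_real_derivative_iff_has_vector_derivative)
  have sin': "((\<lambda>s. sin (\<phi> s)) has_real_derivative - K t) (at t within I)" if "t \<in> I" for t
    using \<phi>'[OF that] K that by (auto intro!: derivative_eq_intros)
  have cos_cont: "continuous_on I (\<lambda>s. cos (\<phi> s))"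
    by (intro continuous_on_cos, rule DERIV_continuous_on) (rule \<phi>')

  show ?thesis
  proof (intro conjI allI impI; (elim conjE)?)
    fix \<alpha> :: "real \<Rightarrow> real"
    assume KJ: "\<forall>t\<in>I. K t = \<alpha> t * J t"
    have K_eq: "- K t = \<alpha> t * \<beta> t * x t" if "t \<in> I" for t
      using KJ J that by simp
    show "\<forall>t\<in>I. \<beta> t * deriv_on I (deriv_on I x) t - deriv_on I \<beta> t * deriv_on I x t
                 + \<alpha> t * (\<beta> t) ^ 3 * x t = 0"
    proof
      fix t assume t: "t \<in> I"
      have dx: "deriv_on I x s = - \<beta> s * sin (\<phi> s)" if "s \<in> I" for s
        using deriv_on_eqI[OF interval(1,2) that] x'[OF that]
        by (simp add: has_real_derivative_iff_has_vector_derivative)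
      have "((\<lambda>s. - \<beta> s * sin (\<phi> s)) has_real_derivative
              - deriv_on I \<beta> t * sin (\<phi> t) + \<beta> t * K t) (at t within I)"
        using DERIV_mult[OF DERIV_minus[OF \<beta>'[OF t]] sin'[OF t]] by (simp add: mult.commute)
      hence "(deriv_on I x has_vector_derivative
              - deriv_on I \<beta> t * sin (\<phi> t) + \<beta> t * K t) (at t within I)"
        unfolding has_real_derivative_iff_has_vector_derivative
        by (rule has_vector_derivative_transform[OF t, rotated]) (simp add: dx)
      hence ddx: "deriv_on I (deriv_on I x) t = - deriv_on I \<beta> t * sin (\<phi> t) + \<beta> t * K t"
        by (rule deriv_on_eqI[OF interval(1,2) t])
      have "K t = - (\<alpha> t * \<beta> t * x t)"
        using K_eq[OF t] by simp
      thus "\<beta> t * deriv_on I (deriv_on I x) t - deriv_on I \<beta> t * deriv_on I x t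
              + \<alpha> t * (\<beta> t) ^ 3 * x t = 0"
        unfolding ddx dx[OF t] by algebra
    qed
    obtain \<epsilon> where \<epsilon>: "sign_choice I (\<lambda>t. sin (\<phi> t)) \<epsilon>"
        "\<And>t. t \<in> I \<Longrightarrow> cos (\<phi> t) = \<epsilon> t * sqrt (1 - (sin (\<phi> t))\<^sup>2)"
      using sign_choice_of_unit_circle[OF cos_cont, of "\<lambda>t. sin (\<phi> t)"] by auto
    show "\<exists>S \<epsilon> :: real \<Rightarrow> real.
            antiderivative_on I (\<lambda>t. \<alpha> t * \<beta> t * x t) S \<and>
            sign_choice I S \<epsilon> \<and>
            antiderivative_on I (\<lambda>t. \<epsilon> t * (\<beta> t * sqrt (1 - (S t)\<^sup>2))) z \<and>
            (\<forall>t\<in>I. cos (\<phi> t) = \<epsilon> t * sqrt (1 - (S t)\<^sup>2) \<and> sin (\<phi> t) = S t)"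
    proof (rule exI[of _ "\<lambda>t. sin (\<phi> t)"], rule exI[of _ \<epsilon>], intro conjI ballI)
      show "antiderivative_on I (\<lambda>t. \<alpha> t * \<beta> t * x t) (\<lambda>t. sin (\<phi> t))"
        unfolding antiderivative_on_def using sin' K_eq by metis
      show "antiderivative_on I (\<lambda>t. \<epsilon> t * (\<beta> t * sqrt (1 - (sin (\<phi> t))\<^sup>2))) z"
        unfolding antiderivative_on_def
      proof
        fix t assume t: "t \<in> I"
        have "\<beta> t * cos (\<phi> t) = \<epsilon> t * (\<beta> t * sqrt (1 - (sin (\<phi> t))\<^sup>2))"
          by (subst \<epsilon>(2)[OF t]) (rule mult.left_commute)
        from z'[OF t, unfolded this]
        show "(z has_real_derivative \<epsilon> t * (\<beta> t * sqrt (1 - (sin (\<phi> t))\<^sup>2))) (at t within I)" .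
      qed
    qed (rule \<epsilon>(1), erule \<epsilon>(2), rule refl)
  next
    assume pos: "x t\<^sub>0 > 0"
    have "continuous_on I x"
      by (rule DERIV_continuous_on) (rule x')
    then obtain \<delta> where \<delta>: "\<delta> > 0" "\<And>t. t \<in> I \<Longrightarrow> dist t t\<^sub>0 < \<delta> \<Longrightarrow> dist (x t) (x t\<^sub>0) < x t\<^sub>0"
      using pos interval(3) unfolding continuous_on_iff by meson
    define U where "U = I \<inter> {t\<^sub>0 - \<delta><..<t\<^sub>0 + \<delta>}"
    have UI: "U \<subseteq> I" by (simp add: U_def)
    have xpos: "x t > 0" if "t \<in> U" for t
      using \<delta>(2)[of t] that by (auto simp: U_def dist_real_def abs_less_iff)
    have \<beta>_eq: "\<beta> t = - J t / x t" if "t \<in> U" for t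
      using J xpos[OF that] that UI by (auto simp: field_simps)
    obtain \<epsilon> where \<epsilon>: "sign_choice U (\<lambda>t. - sin (\<phi> t)) \<epsilon>"
        "\<And>t. t \<in> U \<Longrightarrow> cos (\<phi> t) = \<epsilon> t * sqrt (1 - (- sin (\<phi> t))\<^sup>2)"
      by (rule sign_choice_of_unit_circle[OF continuous_on_subset[OF cos_cont UI],
            of "\<lambda>t. - sin (\<phi> t)"]) auto
    have "\<exists>S P \<epsilon> :: real \<Rightarrow> real.
            antiderivative_on U K S \<and>
            antiderivative_on U (\<lambda>t. J t * S t) P \<and>
            sign_choice U S \<epsilon> \<and>
            (\<forall>t\<in>U. x t > 0 \<and> x t = sqrt (- 2 * P t)) \<and>
            antiderivative_on U (\<lambda>t. - \<epsilon> t * (J t / x t * sqrt (1 - (S t)\<^sup>2))) z \<and>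
            (\<forall>t\<in>U. cos (\<phi> t) = \<epsilon> t * sqrt (1 - (S t)\<^sup>2) \<and> sin (\<phi> t) = - S t)"
    proof (rule exI[of _ "\<lambda>t. - sin (\<phi> t)"], rule exI[of _ "\<lambda>t. - (x t)\<^sup>2 / 2"],
        rule exI[of _ \<epsilon>], intro conjI)
      show "antiderivative_on U K (\<lambda>t. - sin (\<phi> t))"
        unfolding antiderivative_on_def
      proof
        fix t assume "t \<in> U"
        hence t: "t \<in> I" using UI by blast
        show "((\<lambda>t. - sin (\<phi> t)) has_real_derivative K t) (at t within U)"
          using DERIV_minus[OF DERIV_subset[OF sin'[OF t] UI]] by simp
      qed
      show "antiderivative_on U (\<lambda>t. J t * - sin (\<phi> t)) (\<lambda>t. - (x t)\<^sup>2 / 2)"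
        unfolding antiderivative_on_def
      proof
        fix t assume "t \<in> U"
        hence t: "t \<in> I" using UI by blast
        show "((\<lambda>t. - (x t)\<^sup>2 / 2) has_real_derivative J t * - sin (\<phi> t)) (at t within U)"
          using DERIV_subset[OF x'[OF t] UI] J t by (auto intro!: derivative_eq_intros)
      qed
      show "\<forall>t\<in>U. x t > 0 \<and> x t = sqrt (- 2 * (- (x t)\<^sup>2 / 2))"
        using xpos by (simp add: less_imp_le)
      show "antiderivative_on U (\<lambda>t. - \<epsilon> t * (J t / x t * sqrt (1 - (- sin (\<phi> t))\<^sup>2))) z"
        unfolding antiderivative_on_def
      proof
        fix t assume t: "t \<in> U"
        have "\<beta> t * cos (\<phi> t) = - \<epsilon> t * (J t / x t * sqrt (1 - (- sin (\<phi> t))\<^sup>2))"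
          by (subst \<epsilon>(2)[OF t], subst \<beta>_eq[OF t]) simp
        from DERIV_subset[OF z'[OF subsetD[OF UI t]] UI, unfolded this]
        show "(z has_real_derivative - \<epsilon> t * (J t / x t * sqrt (1 - (- sin (\<phi> t))\<^sup>2))) (at t within U)" .
      qed
    qed (rule \<epsilon>(1), use \<epsilon>(2) minus_minus in metis)
    with \<delta>(1) U_def show "\<exists>\<delta>>0. \<exists>U. U = I \<inter> {t\<^sub>0 - \<delta><..<t\<^sub>0 + \<delta>} \<and>
          (\<exists>S P \<epsilon> :: real \<Rightarrow> real.
            antiderivative_on U K S \<and>
            antiderivative_on U (\<lambda>t. J t * S t) P \<and>
            sign_choice U S \<epsilon> \<and>
            (\<forall>t\<in>U. x t > 0 \<and> x t = sqrt (- 2 * P t)) \<and>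
            antiderivative_on U (\<lambda>t. - \<epsilon> t * (J t / x t * sqrt (1 - (S t)\<^sup>2))) z \<and>
            (\<forall>t\<in>U. cos (\<phi> t) = \<epsilon> t * sqrt (1 - (S t)\<^sup>2) \<and> sin (\<phi> t) = - S t))"
      by (intro exI[of _ \<delta>] exI[of _ U] conjI)
  qed
qed

end
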